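(* Let $0<r<1$. The metric $ds^*$ has a negatively curved completion inside $B_r$ if and only if $\mathrm{length}(C_r)>2\pi$, where $\mathrm{length}(C_r)$ is the length of $C_r$ with respect to $ds^*$.
   Context: $\mathbb{D}=\{z\in\mathbb{C}: |z|<1\}$ and $\mathbb{D}^*=\{z\in\mathbb{C}: 0<|z|<1\}$. The metric $ds^*$ is the unique complete hyperbolic (curvature $-1$) metric on $\mathbb{D}^*$ conformally equivalent to the Euclidean metric, namely $ds^*=-\frac{1}{|z|\log|z|}\,|dz|$. For $0<r<1$, $C_r$ is the Euclidean circle with center $0$ and radius $r$, and $B_r=\{z: 0<|z|<r\}$ is its interior in $\mathbb{D}^*$. Let $R\subseteq\mathbb{D}$ be a region containing $0$. A Riemannian metric $ds$ on $\mathbb{D}$ is a negatively curved completion of $ds^*$ inside $R$ if: (i) $ds$ is conformally equivalent to $ds^*$, i.e. $ds=e^{u}|dz|$ with $u$ a real function of class $C^2$ on all of $\mathbb{D}$ (including at $0$); (ii) $ds=ds^*$ on $\mathbb{D}\setminus R$; (iii) the Gaussian curvature satisfies $\kappa(ds)<0$ everywhere on $\mathbb{D}$. "Inside $B_r$" means inside the region $R=B_r\cup\{0\}$. *)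

theory Defs
  imports "HOL-Complex_Analysis.Complex_Analysis"
begin

text \<open>
  A metric on a plane domain that is conformal to the Euclidean one, \<open>ds = \<rho>(z) |dz|\<close> with
  \<open>\<rho> > 0\<close>, is represented by its density \<open>\<rho> :: complex \<Rightarrow> real\<close>. Only the values of
  \<open>\<rho>\<close> on the (open) domain in question matter; curvature is a local notion.
\<close>

definition punctured_disc :: "real \<Rightarrow> complex set" where
  "punctured_disc r = {z. 0 < cmod z \<and> cmod z < r}"

definition hyp_density :: "complex \<Rightarrow> real" where
  "hyp_density z = - 1 / (cmod z * ln (cmod z))"

definition C2_on :: "'a::real_normed_vector set \<Rightarrow> ('a \<Rightarrow> 'b::real_normed_vector) \<Rightarrow> bool" where
  "C2_on S u \<longleftrightarrow>
     (\<exists>(u' :: 'a \<Rightarrow> 'a \<Rightarrow>\<^sub>L 'b) (u'' :: 'a \<Rightarrow> 'a \<Rightarrow>\<^sub>L ('a \<Rightarrow>\<^sub>L 'b)).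
        (\<forall>z\<in>S. (u has_derivative blinfun_apply (u' z)) (at z)) \<and>
        (\<forall>z\<in>S. (u' has_derivative blinfun_apply (u'' z)) (at z)) \<and>
        continuous_on S u'')"

text \<open>The sum of the second derivatives along the coordinate lines through \<open>z\<close>.\<close>

definition laplacian :: "('a::euclidean_space \<Rightarrow> real) \<Rightarrow> 'a \<Rightarrow> real" where
  "laplacian f z = (\<Sum>b\<in>Basis. (deriv ^^ 2) (\<lambda>t::real. f (z + t *\<^sub>R b)) 0)"

text \<open>
  The Gaussian curvature of the conformal metric \<open>\<rho>(z) |dz|\<close>. For \<open>\<rho> = exp u\<close>
  near \<open>z\<close> it is \<open>- exp (- 2 u) \<Delta>u\<close>.
\<close>

definition gaussian_curvature :: "(complex \<Rightarrow> real) \<Rightarrow> complex \<Rightarrow> real" where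
  "gaussian_curvature \<rho> z = - laplacian (\<lambda>w. ln (\<rho> w)) z / (\<rho> z)\<^sup>2"

definition conformal_length :: "(complex \<Rightarrow> real) \<Rightarrow> (real \<Rightarrow> complex) \<Rightarrow> real" where
  "conformal_length \<rho> \<gamma> =
     integral {0..1} (\<lambda>t. \<rho> (\<gamma> t) * norm (vector_derivative \<gamma> (at t within {0..1})))"

text \<open>
  \<open>\<rho>\<close> is the density of a negatively curved completion of \<open>ds\<^sup>*\<close> inside the region \<open>R\<close>.
  Since \<open>0 \<in> R\<close>, the singular value of \<^const>\<open>hyp_density\<close> at \<open>0\<close> plays no role.
\<close>

definition negatively_curved_completion :: "complex set \<Rightarrow> (complex \<Rightarrow> real) \<Rightarrow> bool" where
  "negatively_curved_completion R \<rho> \<longleftrightarrow>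
     open R \<and> connected R \<and> 0 \<in> R \<and> R \<subseteq> ball 0 1 \<and>
     (\<exists>u. C2_on (ball 0 1) u \<and> (\<forall>z\<in>ball 0 1. \<rho> z = exp (u z))) \<and>
     (\<forall>z\<in>ball 0 1 - R. \<rho> z = hyp_density z) \<and>
     (\<forall>z\<in>ball 0 1. gaussian_curvature \<rho> z < 0)"

end

theory Submission
  imports Defs
begin

text \<open>
  Why the theorem holds. The circle \<open>C\<^sub>r\<close> has length \<open>- 2\<pi> / ln r\<close>, so the
  length condition says \<open>ln r > - 1\<close>. Write \<open>ds\<^sup>* = exp U |dz|\<close>; up to a positive
  factor the radial derivative of \<open>U\<close> at radius \<open>r\<close> is \<open>- 1 - 1 / ln r\<close>, so the same condition
  says that \<open>U\<close> increases outwards through \<open>C\<^sub>r\<close>. Since \<open>exp u |dz|\<close> has curvature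
  \<open>- exp (- 2 u) \<Delta>u\<close>, the question becomes: when does \<open>U\<close> outside the disc of radius \<open>r\<close>
  extend to a \<open>C\<^sup>2\<close> function with positive Laplacian?

  Necessity. An extension \<open>u\<close> is strictly subharmonic and constant on \<open>C\<^sub>r\<close>, so by the boundary
  point principle of Hopf (\<open>hopf_boundary_derivative\<close>) its outward derivative there is strictly
  positive. Being \<open>C\<^sup>1\<close> and equal to \<open>U\<close> outside, \<open>u\<close> has the same derivative as \<open>U\<close>. (One may
  also integrate \<open>\<Delta>u > 0\<close> over the disc; the maximum principle avoids integration.)

  Sufficiency. A radial extension suffices. In the variable \<open>x = |z|\<^sup>2\<close>, which unlike \<open>|z|\<close> is smooth
  at the origin, \<open>u z = h x\<close> has Laplacian \<open>4 (x h')'\<close>. Hence an increasing function \<open>x h'\<close>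
  that vanishes at \<open>0\<close> has to reach a given value and a given positive slope at \<open>x = r\<^sup>2\<close>.
  This is possible as soon as that value is positive, and \<open>x h' = A x + B x\<^sup>n\<^sup>+\<^sup>1 / (n + 1)\<close> with \<open>n\<close> large
  does it (\<open>exists_subharmonic_cap\<close>). Matching \<open>h\<close>, \<open>h'\<close> and \<open>(x h')'\<close> at \<open>r\<^sup>2\<close> makes the glued
  function \<open>C\<^sup>2\<close>.
\<close>

section \<open>The Laplacian and the Hessian\<close>

lemma has_vector_derivative_along_line:
  assumes "(u has_derivative blinfun_apply D) (at (z + t *\<^sub>R b))"
  shows "((\<lambda>s. u (z + s *\<^sub>R b)) has_vector_derivative blinfun_apply D b) (at t)"
proof -
  have "((\<lambda>s. z + s *\<^sub>R b) has_vector_derivative b) (at t)"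
    by (auto intro!: derivative_eq_intros simp: has_vector_derivative_def)
  from vector_derivative_diff_chain_within[OF this, of u "blinfun_apply D"] assms
  show ?thesis by (simp add: o_def has_derivative_at_withinI)
qed

lemma eventually_line_in_open:
  fixes z b :: "'a::real_normed_vector"
  assumes "open S" "z \<in> S"
  shows "eventually (\<lambda>t::real. z + t *\<^sub>R b \<in> S) (nhds 0)"
proof -
  have "filterlim (\<lambda>t::real. z + t *\<^sub>R b) (nhds z) (nhds 0)"
    by (auto intro!: tendsto_eq_intros filterlim_ident)
  then show ?thesis using assms by (auto simp: tendsto_def)
qed

lemma laplacian_cong:
  fixes f g :: "'a::euclidean_space \<Rightarrow> real"
  assumes "open S" "z \<in> S" "\<And>w. w \<in> S \<Longrightarrow> f w = g w"
  shows "laplacian f z = laplacian g z"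
  unfolding laplacian_def
proof (intro sum.cong refl higher_deriv_cong_ev)
  fix b :: 'a
  show "eventually (\<lambda>t::real. f (z + t *\<^sub>R b) = g (z + t *\<^sub>R b)) (nhds 0)"
    using eventually_line_in_open[OF assms(1,2), of b] by eventually_elim (simp add: assms(3))
qed

text \<open>
  The link between the Laplacian, which is made of iterated derivatives along coordinate lines, and
  the derivatives provided by \<^const>\<open>C2_on\<close>.
\<close>

lemma laplacian_eq_trace_hessian:
  fixes u :: "'a::euclidean_space \<Rightarrow> real" and u'' :: "'a \<Rightarrow>\<^sub>L 'a \<Rightarrow>\<^sub>L real"
  assumes "open S" "z \<in> S"
    and u': "\<And>w. w \<in> S \<Longrightarrow> (u has_derivative blinfun_apply (u' w)) (at w)"
    and u'': "(u' has_derivative blinfun_apply u'') (at z)"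
  shows "laplacian u z = (\<Sum>b\<in>Basis. blinfun_apply (blinfun_apply u'' b) b)"
  unfolding laplacian_def
proof (intro sum.cong refl)
  fix b :: 'a
  have "eventually (\<lambda>t. deriv (\<lambda>t. u (z + t *\<^sub>R b)) t = u' (z + t *\<^sub>R b) b) (nhds 0)"
    using eventually_line_in_open[OF assms(1,2), of b]
  proof eventually_elim
    case (elim t)
    from has_vector_derivative_along_line[OF u'[OF this]] show ?case
      by (simp add: DERIV_imp_deriv has_real_derivative_iff_has_vector_derivative)
  qed
  then have "(deriv ^^ 2) (\<lambda>t. u (z + t *\<^sub>R b)) 0 = deriv (\<lambda>t. u' (z + t *\<^sub>R b) b) 0"
    by (simp add: numeral_2_eq_2 deriv_cong_ev)
  also have "((\<lambda>t. u' (z + t *\<^sub>R b)) has_vector_derivative u'' b) (at 0)"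
    by (rule has_vector_derivative_along_line) (simp add: u'')
  then have "((\<lambda>t. u' (z + t *\<^sub>R b) b) has_vector_derivative u'' b b) (at 0)"
    by (rule bounded_linear.has_vector_derivative[OF blinfun.bounded_linear_left])
  then have "deriv (\<lambda>t. u' (z + t *\<^sub>R b) b) 0 = u'' b b"
    by (simp add: DERIV_imp_deriv has_real_derivative_iff_has_vector_derivative)
  finally show "(deriv ^^ 2) (\<lambda>t. u (z + t *\<^sub>R b)) 0 = u'' b b" .
qed

text \<open>
  Curvature enters the problem only through its sign, so from here on metrics are replaced by
  their logarithmic densities.
\<close>

lemma gaussian_curvature_neg_iff:
  assumes "open S" "z \<in> S" "\<And>w. w \<in> S \<Longrightarrow> \<rho> w = exp (u w)"
  shows "gaussian_curvature \<rho> z < 0 \<longleftrightarrow> 0 < laplacian u z"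
proof -
  have "laplacian (\<lambda>w. ln (\<rho> w)) z = laplacian u z"
    by (rule laplacian_cong[OF assms(1,2)]) (simp add: assms(3))
  then show ?thesis
    using assms(3)[OF assms(2)] by (simp add: gaussian_curvature_def zero_less_divide_iff)
qed

section \<open>Radial functions\<close>

text \<open>
  First and second derivative of \<open>z \<mapsto> h (z \<bullet> z)\<close>. Both are given explicitly as bounded
  linear maps because \<^const>\<open>C2_on\<close> asks for them in this form.
\<close>

definition radial_gradient :: "(real \<Rightarrow> real) \<Rightarrow> 'a::real_inner \<Rightarrow> 'a \<Rightarrow>\<^sub>L real" where
  "radial_gradient h' z = (2 * h' (z \<bullet> z)) *\<^sub>R blinfun_inner_right z"

definition radial_hessian ::
    "(real \<Rightarrow> real) \<Rightarrow> (real \<Rightarrow> real) \<Rightarrow> 'a::real_inner \<Rightarrow> 'a \<Rightarrow>\<^sub>L 'a \<Rightarrow>\<^sub>L real" where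
  "radial_hessian h' h'' z =
     (2 * h' (z \<bullet> z)) *\<^sub>R Blinfun blinfun_inner_right +
     (4 * h'' (z \<bullet> z)) *\<^sub>R (blinfun_scaleR_left (blinfun_inner_right z) o\<^sub>L blinfun_inner_right z)"

lemma radial_gradient_apply:
  "blinfun_apply (radial_gradient h' z) = (\<lambda>v. 2 * h' (z \<bullet> z) * (z \<bullet> v))"
  by (simp add: fun_eq_iff radial_gradient_def blinfun.scaleR_left)

lemma radial_hessian_apply:
  "radial_hessian h' h'' z v =
     (2 * h' (z \<bullet> z)) *\<^sub>R blinfun_inner_right v +
     (4 * h'' (z \<bullet> z) * (z \<bullet> v)) *\<^sub>R blinfun_inner_right z"
  by (simp add: radial_hessian_def blinfun.add_left blinfun.scaleR_left
      bounded_linear_Blinfun_apply[OF bounded_linear_blinfun_inner_right])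

lemma has_derivative_radial:
  fixes z :: "'a::real_inner"
  assumes "(h has_real_derivative h' (z \<bullet> z)) (at (z \<bullet> z))"
  shows "((\<lambda>z. h (z \<bullet> z)) has_derivative blinfun_apply (radial_gradient h' z)) (at z)"
proof -
  have "((\<lambda>z. z \<bullet> z) has_derivative (\<lambda>v. 2 * (z \<bullet> v))) (at z)"
    by (auto intro!: derivative_eq_intros simp: inner_commute)
  from has_derivative_compose[OF this] assms
  have "((\<lambda>z. h (z \<bullet> z)) has_derivative (\<lambda>v. h' (z \<bullet> z) * (2 * (z \<bullet> v)))) (at z)"
    by (simp add: has_field_derivative_def)
  then show ?thesis
    by (simp add: radial_gradient_apply mult_ac)
qed

lemma has_derivative_radial_gradient:
  fixes z :: "'a::real_inner"
  assumes "(h' has_real_derivative h'' (z \<bullet> z)) (at (z \<bullet> z))"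
  shows "(radial_gradient h' has_derivative blinfun_apply (radial_hessian h' h'' z)) (at z)"
proof -
  have 1: "((\<lambda>z. h' (z \<bullet> z)) has_derivative (\<lambda>v. 2 * h'' (z \<bullet> z) * (z \<bullet> v))) (at z)"
    using has_derivative_radial[of h' h'' z, OF assms]
    by (simp add: radial_gradient_apply)
  have 2: "((\<lambda>z::'a. blinfun_inner_right z) has_derivative (\<lambda>v. blinfun_inner_right v)) (at z)"
    by (rule bounded_linear.has_derivative[OF bounded_linear_blinfun_inner_right has_derivative_ident])
  show ?thesis
    unfolding radial_gradient_def radial_hessian_apply
    by (rule has_derivative_eq_rhs,
        rule has_derivative_scaleR[OF has_derivative_mult_right[OF 1] 2])
       (auto simp: fun_eq_iff mult_ac)
qed

lemma C2_on_radial: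
  fixes S :: "'a::real_inner set"
  assumes "\<And>z. z \<in> S \<Longrightarrow> z \<bullet> z \<in> I"
    and h': "\<And>x. x \<in> I \<Longrightarrow> (h has_real_derivative h' x) (at x)"
    and h'': "\<And>x. x \<in> I \<Longrightarrow> (h' has_real_derivative h'' x) (at x)"
    and "continuous_on I h''"
  shows "C2_on S (\<lambda>z. h (z \<bullet> z))"
proof -
  have "continuous_on I h'"
    using h'' by (meson DERIV_continuous continuous_at_imp_continuous_on)
  then have 1: "continuous_on S (\<lambda>z. h' (z \<bullet> z))"
    by (rule continuous_on_compose2) (auto intro!: continuous_intros assms(1))
  have 2: "continuous_on S (\<lambda>z. h'' (z \<bullet> z))"
    by (rule continuous_on_compose2[OF assms(4)]) (auto intro!: continuous_intros assms(1))
  have "continuous_on S (radial_hessian h' h'')"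
    unfolding radial_hessian_def
    by (intro continuous_intros 1 2
        bounded_bilinear.continuous_on[OF bounded_bilinear_blinfun_compose]
        bounded_linear.continuous_on[OF bounded_linear_blinfun_scaleR_left]
        bounded_linear.continuous_on[OF bounded_linear_blinfun_inner_right])
  then show ?thesis
    unfolding C2_on_def using assms(1) h' h''
    by (intro exI[of _ "radial_gradient h'"] exI[of _ "radial_hessian h' h''"])
       (auto intro!: has_derivative_radial has_derivative_radial_gradient)
qed

text \<open>In the plane the right-hand side is \<open>4 (x h')'\<close> at \<open>x = z \<bullet> z\<close>.\<close>

lemma trace_radial_hessian:
  fixes z :: "'a::euclidean_space" and h' h'' :: "real \<Rightarrow> real"
  shows "(\<Sum>b\<in>Basis. blinfun_apply (blinfun_apply (radial_hessian h' h'' z) b) b) =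
           2 * DIM('a) * h' (z \<bullet> z) + 4 * h'' (z \<bullet> z) * (z \<bullet> z)"
proof -
  have "(\<Sum>b\<in>Basis. blinfun_apply (blinfun_apply (radial_hessian h' h'' z) b) b) =
        (\<Sum>b\<in>Basis. 2 * h' (z \<bullet> z) * (b \<bullet> b) + 4 * h'' (z \<bullet> z) * ((z \<bullet> b) * (z \<bullet> b)))"
    by (simp add: radial_hessian_apply blinfun.add_left blinfun.scaleR_left mult_ac)
  also have "\<dots> = 2 * h' (z \<bullet> z) * (\<Sum>b\<in>(Basis::'a set). b \<bullet> b) +
      4 * h'' (z \<bullet> z) * (\<Sum>b\<in>Basis. (z \<bullet> b) * (z \<bullet> b))"
    by (simp add: sum.distrib sum_distrib_left)
  also have "(\<Sum>b\<in>(Basis::'a set). b \<bullet> b) = DIM('a)" by simp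
  also have "(\<Sum>b\<in>Basis. (z \<bullet> b) * (z \<bullet> b)) = z \<bullet> z"
    by (rule euclidean_inner[symmetric])
  finally show ?thesis by simp
qed

section \<open>The boundary point principle\<close>

lemma second_derivative_nonpos_at_max:
  fixes g g' :: "real \<Rightarrow> real"
  assumes "0 < d"
    and g': "\<And>t. \<bar>t\<bar> < d \<Longrightarrow> (g has_real_derivative g' t) (at t)"
    and g'': "(g' has_real_derivative D) (at 0)"
    and max: "\<And>t. \<bar>t\<bar> < d \<Longrightarrow> g t \<le> g 0"
  shows "D \<le> 0"
proof (rule ccontr)
  assume "\<not> D \<le> 0"
  have "g' 0 = 0"
    using DERIV_local_max[OF g'[of 0] \<open>0 < d\<close>] max \<open>0 < d\<close> by auto
  obtain e where e: "e > 0" "\<And>h. 0 < h \<Longrightarrow> h < e \<Longrightarrow> g' 0 < g' (0 + h)"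
    using DERIV_pos_inc_right[OF g''] \<open>\<not> D \<le> 0\<close> by (metis not_le)
  define t where "t = min d e / 2"
  have t: "0 < t" "t < d" "t < e" using \<open>0 < d\<close> e(1) by (auto simp: t_def min_def)
  obtain s where "0 < s" "s < t" "g t - g 0 = (t - 0) * g' s"
    using MVT2[of 0 t g g'] t g' by (metis abs_of_nonneg le_less_trans)
  moreover have "g' s > 0" using e(2)[of s] \<open>g' 0 = 0\<close> calculation t by auto
  ultimately have "g t > g 0" using t by (metis diff_gt_0_iff_gt diff_zero mult_pos_pos)
  then show False using max[of t] t by simp
qed

lemma hessian_nonpos_at_max:
  fixes u :: "'a::real_normed_vector \<Rightarrow> real" and u'' :: "'a \<Rightarrow>\<^sub>L 'a \<Rightarrow>\<^sub>L real"
  assumes "open S" "z \<in> S"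
    and u': "\<And>w. w \<in> S \<Longrightarrow> (u has_derivative blinfun_apply (u' w)) (at w)"
    and u'': "(u' has_derivative blinfun_apply u'') (at z)"
    and max: "\<And>w. w \<in> S \<Longrightarrow> u w \<le> u z"
  shows "blinfun_apply (blinfun_apply u'' b) b \<le> 0"
proof -
  obtain d where "d > 0" and d: "\<And>t::real. \<bar>t\<bar> < d \<Longrightarrow> z + t *\<^sub>R b \<in> S"
    using eventually_line_in_open[OF assms(1,2), of b] by (auto simp: eventually_nhds_metric)
  have "((\<lambda>t. u' (z + t *\<^sub>R b)) has_vector_derivative u'' b) (at 0)"
    by (rule has_vector_derivative_along_line) (simp add: u'')
  then have "((\<lambda>t. u' (z + t *\<^sub>R b) b) has_vector_derivative u'' b b) (at 0)"
    by (rule bounded_linear.has_vector_derivative[OF blinfun.bounded_linear_left])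
  then have "((\<lambda>t. u' (z + t *\<^sub>R b) b) has_real_derivative u'' b b) (at 0)"
    by (simp add: has_real_derivative_iff_has_vector_derivative)
  then show ?thesis
  proof (rule second_derivative_nonpos_at_max[OF \<open>d > 0\<close>, rotated])
    fix t :: real assume "\<bar>t\<bar> < d"
    then have "z + t *\<^sub>R b \<in> S" by (rule d)
    then show "((\<lambda>t. u (z + t *\<^sub>R b)) has_real_derivative u' (z + t *\<^sub>R b) b) (at t)"
      using has_vector_derivative_along_line[OF u']
      by (simp add: has_real_derivative_iff_has_vector_derivative)
    show "u (z + t *\<^sub>R b) \<le> u (z + 0 *\<^sub>R b)" using max \<open>z + t *\<^sub>R b \<in> S\<close> by simp
  qed
qed

text \<open>
  Hopf's boundary point principle for a strictly subharmonic function whose maximum over a sphere is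
  attained at \<open>r e\<close>. On the compact closed ball the Laplacian has a positive lower bound, so subtracting
  \<open>k |z|\<^sup>2\<close> with a small \<open>k > 0\<close> keeps \<open>u\<close> strictly subharmonic. The difference still has its maximum
  at \<open>r e\<close> and hence a nonnegative outward derivative there; the subtracted term adds \<open>2 k r > 0\<close>.
\<close>

lemma hopf_boundary_derivative:
  fixes u :: "'a::euclidean_space \<Rightarrow> real"
  assumes "C2_on S u" "open S" "cball 0 r \<subseteq> S" "0 < r" "norm e = 1"
    and subharmonic: "\<And>z. z \<in> cball 0 r \<Longrightarrow> 0 < laplacian u z"
    and boundary: "\<And>z. norm z = r \<Longrightarrow> u z \<le> u (r *\<^sub>R e)"
    and deriv: "((\<lambda>t. u (t *\<^sub>R e)) has_real_derivative D) (at r)"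
  shows "0 < D"
proof -
  obtain u' :: "'a \<Rightarrow> 'a \<Rightarrow>\<^sub>L real" and u'' :: "'a \<Rightarrow> 'a \<Rightarrow>\<^sub>L 'a \<Rightarrow>\<^sub>L real" where
    u': "\<And>z. z \<in> S \<Longrightarrow> (u has_derivative blinfun_apply (u' z)) (at z)" and
    u'': "\<And>z. z \<in> S \<Longrightarrow> (u' has_derivative blinfun_apply (u'' z)) (at z)" and
    cont: "continuous_on S u''"
    using assms(1) unfolding C2_on_def by blast
  have lap: "laplacian u z = (\<Sum>b\<in>Basis. u'' z b b)" if "z \<in> S" for z
    using laplacian_eq_trace_hessian[OF \<open>open S\<close> that u' u''[OF that]] .
  have "continuous_on (cball 0 r) (laplacian u)"
  proof (rule continuous_on_eq)
    show "continuous_on (cball 0 r) (\<lambda>z. \<Sum>b\<in>Basis. u'' z b b)"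
      by (intro continuous_intros continuous_on_subset[OF cont assms(3)])
  qed (use lap assms(3) in auto)
  then obtain z1 where z1: "z1 \<in> cball 0 r" "\<And>z. z \<in> cball 0 r \<Longrightarrow> laplacian u z1 \<le> laplacian u z"
    using continuous_attains_inf[OF compact_cball, of 0 r "laplacian u"] \<open>0 < r\<close> by auto
  \<comment> \<open>The Laplacian of \<open>k |z|\<^sup>2\<close> is \<open>2 DIM('a) k\<close>, half of the lower bound.\<close>
  define k where "k = laplacian u z1 / (4 * DIM('a))"
  have "0 < k" using subharmonic[OF z1(1)] by (simp add: k_def)
  have lap_gt: "2 * real DIM('a) * k < laplacian u z" if "z \<in> cball 0 r" for z
    using z1(2)[OF that] subharmonic[OF z1(1)] by (simp add: k_def)
  define w where "w z = u z - k * (z \<bullet> z)" for z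
  define w' where "w' z = u' z - radial_gradient (\<lambda>_. k) z" for z
  define w'' where "w'' z = u'' z - radial_hessian (\<lambda>_. k) (\<lambda>_. 0) z" for z
  have w': "(w has_derivative blinfun_apply (w' z)) (at z)" if "z \<in> S" for z
  proof -
    have "((\<lambda>z. k * (z \<bullet> z)) has_derivative blinfun_apply (radial_gradient (\<lambda>_. k) z)) (at z)"
      by (rule has_derivative_radial[where h = "\<lambda>x. k * x"]) (auto intro!: derivative_eq_intros)
    from has_derivative_diff[OF u'[OF that] this] show ?thesis
      by (simp add: w_def[abs_def] w'_def minus_blinfun.rep_eq)
  qed
  have w'': "(w' has_derivative blinfun_apply (w'' z)) (at z)" if "z \<in> S" for z
    using has_derivative_diff[OF u''[OF that] has_derivative_radial_gradient[of "\<lambda>x. k" "\<lambda>_. 0" z]]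
    by (simp add: w'_def[abs_def] w''_def minus_blinfun.rep_eq)
  have "continuous_on S w" using w' by (meson continuous_at_imp_continuous_on has_derivative_continuous)
  then have "continuous_on (cball 0 r) w" using assms(3) by (rule continuous_on_subset)
  then obtain z0 where z0: "z0 \<in> cball 0 r" "\<And>z. z \<in> cball 0 r \<Longrightarrow> w z \<le> w z0"
    using continuous_attains_sup[OF compact_cball, of 0 r w] \<open>0 < r\<close> by auto
  \<comment> \<open>At an interior maximum the trace of the Hessian of \<open>w\<close> would be at most \<open>0\<close>,
    while the Laplacian of \<open>w\<close> is positive.\<close>
  have "norm z0 = r"
  proof (rule ccontr)
    assume "norm z0 \<noteq> r"
    then have "z0 \<in> ball 0 r" using z0(1) by simp
    have "w'' z0 b b \<le> 0" for b
    proof (rule hessian_nonpos_at_max[OF open_ball \<open>z0 \<in> ball 0 r\<close>])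
      show "(w has_derivative blinfun_apply (w' z)) (at z)" if "z \<in> ball 0 r" for z
        using that assms(3) by (intro w') auto
      show "(w' has_derivative blinfun_apply (w'' z0)) (at z0)"
        using z0(1) assms(3) by (intro w'') auto
    qed (use z0(2) in auto)
    then have "(\<Sum>b\<in>Basis. w'' z0 b b) \<le> 0" by (rule sum_nonpos)
    also have "(\<Sum>b\<in>Basis. w'' z0 b b) = laplacian u z0 - 2 * real DIM('a) * k"
      using lap[of z0] z0(1) assms(3)
        trace_radial_hessian[of "\<lambda>_. k" "\<lambda>_. 0" z0]
      by (auto simp: w''_def blinfun.diff_left sum_subtractf)
    finally show False using lap_gt[OF z0(1)] by simp
  qed
  have "norm (r *\<^sub>R e) = r" using assms(4,5) by simp
  then have "w z0 \<le> w (r *\<^sub>R e)"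
    using boundary[OF \<open>norm z0 = r\<close>] \<open>norm z0 = r\<close> by (simp add: w_def dot_square_norm)
  then have max: "w (t *\<^sub>R e) \<le> w (r *\<^sub>R e)" if "0 \<le> t" "t \<le> r" for t
    using z0(2)[of "t *\<^sub>R e"] that assms(5) by simp
  have "e \<bullet> e = 1" using assms(5) by (simp add: dot_square_norm)
  then have "((\<lambda>t. w (t *\<^sub>R e)) has_real_derivative D - 2 * k * r) (at r)"
    unfolding w_def by (auto intro!: derivative_eq_intros deriv)
  moreover have "\<not> D - 2 * k * r < 0"
  proof
    assume "D - 2 * k * r < 0"
    then obtain d where d: "d > 0" "\<And>h. 0 < h \<Longrightarrow> h < d \<Longrightarrow> w (r *\<^sub>R e) < w ((r - h) *\<^sub>R e)"
      using DERIV_neg_dec_left calculation by blast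
    define h where "h = min d r / 2"
    have "0 < h" "h < d" "h < r" using d(1) \<open>0 < r\<close> by (auto simp: h_def min_def)
    then show False using d(2)[of h] max[of "r - h"] by simp
  qed
  ultimately show ?thesis using mult_pos_pos[OF \<open>0 < k\<close> \<open>0 < r\<close>] by linarith
qed

section \<open>Gluing functions of a real variable\<close>

definition glue_at :: "real \<Rightarrow> (real \<Rightarrow> real) \<Rightarrow> (real \<Rightarrow> real) \<Rightarrow> real \<Rightarrow> real" where
  "glue_at a f g x = (if x \<le> a then f x else g x)"

lemma DERIV_glue_at:
  assumes f: "\<And>x. x \<le> a \<Longrightarrow> (f has_real_derivative f' x) (at x)"
    and g: "\<And>x. a \<le> x \<Longrightarrow> x < b \<Longrightarrow> (g has_real_derivative g' x) (at x)"
    and "f a = g a" "f' a = g' a" "x < b"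
  shows "(glue_at a f g has_real_derivative glue_at a f' g' x) (at x)"
proof -
  have "((\<lambda>x. if x \<in> {..a} then f x else g x) has_derivative
      (if x \<in> {..a} then (*) (f' x) else (*) (g' x))) (at x within {..a} \<union> {a<..})"
    by (rule has_derivative_If_within_closures
          [where T = "{a<..}" and S = "{..a}" and f' = "\<lambda>x. (*) (f' x)" and g' = "\<lambda>x. (*) (g' x)"])
       (use f g assms(3-5) in \<open>auto simp: has_field_derivative_def has_derivative_at_withinI\<close>)
  moreover have "{..a} \<union> {a<..} = UNIV" by auto
  ultimately show ?thesis
    by (auto simp: glue_at_def[abs_def] has_field_derivative_def split: if_splits)
qed

lemma continuous_on_glue_at:
  assumes "a < b" "continuous_on {..a} f" "continuous_on {a..<b} g" "f a = g a"
  shows "continuous_on {..<b} (glue_at a f g)"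
proof -
  \<comment> \<open>The correction \<open>- g a\<close> cancels the piece that stays at its value at \<open>a\<close>.\<close>
  have "continuous_on {..<b} (\<lambda>x. f (min x a) + g (max x a) - g a)"
    by (intro continuous_intros continuous_on_compose2[OF assms(2)]
        continuous_on_compose2[OF assms(3)]) (use assms(1) in auto)
  moreover have "f (min x a) + g (max x a) - g a = glue_at a f g x" for x
    using assms(4) by (auto simp: glue_at_def min_def max_def)
  ultimately show ?thesis by simp
qed

lemma DERIV_unique_at_right:
  fixes f g :: "real \<Rightarrow> real"
  assumes "(f has_real_derivative D) (at a)" "(g has_real_derivative E) (at a)"
    and "a < b" "\<And>x. a \<le> x \<Longrightarrow> x < b \<Longrightarrow> f x = g x"
  shows "D = E"
proof -
  have "((\<lambda>x. (f x - f a) / (x - a)) \<longlongrightarrow> D) (at_right a)"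
    using has_field_derivative_at_within[OF assms(1)] by (simp add: has_field_derivative_iff)
  moreover have "((\<lambda>x. (g x - g a) / (x - a)) \<longlongrightarrow> E) (at_right a)"
    using has_field_derivative_at_within[OF assms(2)] by (simp add: has_field_derivative_iff)
  then have "((\<lambda>x. (f x - f a) / (x - a)) \<longlongrightarrow> E) (at_right a)"
    by (rule Lim_transform_eventually)
       (use assms(3,4) in \<open>auto simp: eventually_at_right[OF assms(3)]\<close>)
  ultimately show ?thesis by (intro tendsto_unique[OF trivial_limit_at_right_real])
qed

section \<open>The punctured hyperbolic disc\<close>

lemma insert_0_punctured_disc: "0 < r \<Longrightarrow> insert 0 (punctured_disc r) = ball 0 r"
  by (auto simp: punctured_disc_def)

lemma conformal_length_hyp_circle:
  assumes "0 < r" "r < 1"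
  shows "conformal_length hyp_density (circlepath 0 r) = - 2 * pi / ln r"
proof -
  have "conformal_length hyp_density (circlepath 0 r) = integral {0..1::real} (\<lambda>t. - 2 * pi / ln r)"
    unfolding conformal_length_def
  proof (rule integral_cong)
    fix t :: real assume "t \<in> {0..1}"
    then show "hyp_density (circlepath 0 r t) *
        norm (vector_derivative (circlepath 0 r) (at t within {0..1})) = - 2 * pi / ln r"
      using assms by (simp add: vector_derivative_circlepath01 norm_mult hyp_density_def)
        (simp add: circlepath norm_mult)
  qed
  then show ?thesis by simp
qed

lemma length_hyp_circle_gt_iff:
  assumes "0 < r" "r < 1"
  shows "conformal_length hyp_density (circlepath 0 r) > 2 * pi \<longleftrightarrow> ln r > - 1"
proof -
  have "ln r < 0" using assms by simp
  have "conformal_length hyp_density (circlepath 0 r) > 2 * pi \<longleftrightarrow> 2 * pi * 1 < 2 * pi * (- 1 / ln r)"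
    unfolding conformal_length_hyp_circle[OF assms] by simp
  also have "\<dots> \<longleftrightarrow> 1 < - 1 / ln r" by (subst mult_less_cancel_left_pos) auto
  also have "\<dots> \<longleftrightarrow> ln r > - 1" using \<open>ln r < 0\<close> by (auto simp: field_simps)
  finally show ?thesis .
qed

text \<open>
  The logarithm of the density of \<open>ds\<^sup>*\<close> as a function of \<open>x = |z|\<^sup>2\<close>, followed by its first two
  derivatives.
\<close>

definition hyp_potential :: "real \<Rightarrow> real" where
  "hyp_potential x = - ln x / 2 - ln (- ln x / 2)"

definition hyp_potential' :: "real \<Rightarrow> real" where
  "hyp_potential' x = - 1 / (2 * x) - 1 / (x * ln x)"

definition hyp_potential'' :: "real \<Rightarrow> real" where
  "hyp_potential'' x = 1 / (2 * x\<^sup>2) + (ln x + 1) / (x * ln x)\<^sup>2"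

lemma hyp_density_eq_exp_potential:
  assumes "0 < cmod z" "cmod z < 1"
  shows "hyp_density z = exp (hyp_potential (z \<bullet> z))"
proof -
  have "ln (cmod z) < 0" using assms by simp
  moreover have "ln (z \<bullet> z) = 2 * ln (cmod z)"
    using assms by (simp add: dot_square_norm ln_realpow)
  ultimately have "hyp_potential (z \<bullet> z) = - ln (cmod z) - ln (- ln (cmod z))"
    by (simp add: hyp_potential_def)
  then have "exp (hyp_potential (z \<bullet> z)) = inverse (cmod z) / (- ln (cmod z))"
    using assms \<open>ln (cmod z) < 0\<close> by (simp only: exp_diff exp_minus exp_ln neg_0_less_iff_less)
  then show ?thesis by (simp add: hyp_density_def divide_simps)
qed

lemma DERIV_hyp_potential:
  assumes "0 < x" "x < 1"
  shows "(hyp_potential has_real_derivative hyp_potential' x) (at x)"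
proof -
  have "ln x < 0" using assms by simp
  then show ?thesis unfolding hyp_potential_def[abs_def] hyp_potential'_def
    using assms by (auto intro!: derivative_eq_intros simp: field_simps)
qed

lemma DERIV_hyp_potential':
  assumes "0 < x" "x < 1"
  shows "(hyp_potential' has_real_derivative hyp_potential'' x) (at x)"
proof -
  have "ln x < 0" using assms by simp
  then show ?thesis unfolding hyp_potential'_def[abs_def] hyp_potential''_def
    using assms by (auto intro!: derivative_eq_intros simp: field_simps power2_eq_square)
qed

text \<open>
  The expression is \<open>(x h')'\<close>, a quarter of the Laplacian of the logarithmic density; it equals \<open>1 / (x (ln x)\<^sup>2)\<close>.
\<close>

lemma hyp_potential_subharmonic:
  assumes "0 < x" "x < 1"
  shows "x * hyp_potential'' x + hyp_potential' x > 0"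
proof -
  have "ln x < 0" using assms by simp
  then have "x * hyp_potential'' x + hyp_potential' x = 1 / (x * (ln x)\<^sup>2)"
    unfolding hyp_potential'_def hyp_potential''_def
    using assms by (simp add: field_simps power2_eq_square)
  then show ?thesis using assms \<open>ln x < 0\<close> by simp
qed

text \<open>Together with the formula for the length this turns the length condition into a sign condition
  on the slope of the potential at \<open>C\<^sub>r\<close>.\<close>

lemma hyp_potential'_pos_iff:
  assumes "0 < r" "r < 1"
  shows "hyp_potential' (r\<^sup>2) > 0 \<longleftrightarrow> ln r > - 1"
proof -
  have "ln r < 0" using assms by simp
  have "hyp_potential' (r\<^sup>2) = (1 / (2 * r\<^sup>2)) * (- 1 - 1 / ln r)"
    using assms \<open>ln r < 0\<close> by (simp add: hyp_potential'_def ln_realpow field_simps)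
  then have "hyp_potential' (r\<^sup>2) > 0 \<longleftrightarrow> - 1 - 1 / ln r > 0"
    using assms(1) by (simp only: zero_less_mult_iff) auto
  also have "\<dots> \<longleftrightarrow> ln r > - 1" using \<open>ln r < 0\<close> by (auto simp: field_simps)
  finally show ?thesis .
qed

section \<open>A subharmonic cap\<close>

text \<open>
  The profile that fills in the disc. Since \<open>(x p')' = A + B x\<^sup>n\<close> is monotone, it is positive on
  \<open>[0, a]\<close> if it is positive at both ends. At \<open>a\<close> it has the prescribed value \<open>f\<close>; its
  mean over \<open>[0, a]\<close> has to be the prescribed slope \<open>m\<close>, which forces \<open>A = m - (f - m) / n\<close>. So
  positivity of \<open>A\<close> costs nothing but a large \<open>n\<close>, whatever the positive numbers \<open>f\<close> and \<open>m\<close>.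
\<close>

lemma exists_subharmonic_cap:
  fixes a c f m :: real
  assumes "0 < a" "0 < f" "0 < m"
  obtains p p' p'' :: "real \<Rightarrow> real" where
    "\<And>x. (p has_real_derivative p' x) (at x)"
    "\<And>x. (p' has_real_derivative p'' x) (at x)"
    "continuous_on UNIV p''"
    "p a = c" "p' a = m" "a * p'' a + p' a = f"
    "\<And>x. 0 \<le> x \<Longrightarrow> x \<le> a \<Longrightarrow> 0 < x * p'' x + p' x"
proof -
  obtain n0 where "(f - m) / m < real n0" using reals_Archimedean2 by blast
  define n where "n = Suc n0"
  have "(f - m) / m < n" "0 < real n" using \<open>(f - m) / m < real n0\<close> by (auto simp: n_def)
  \<comment> \<open>These coefficients solve \<open>A + B a\<^sup>n = f\<close> and \<open>A + B a\<^sup>n / (n + 1) = m\<close>.\<close>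
  define A where "A = m - (f - m) / n"
  define B where "B = (f - m) / n * (real n + 1) / a ^ n"
  have "0 < A" using \<open>(f - m) / m < n\<close> \<open>0 < real n\<close> \<open>0 < m\<close> by (simp add: A_def field_simps)
  have Ba: "B * a ^ n = (f - m) / n * (real n + 1)" using \<open>0 < a\<close> by (simp add: B_def)
  have f: "A + B * a ^ n = f" using \<open>0 < real n\<close> unfolding A_def Ba by (simp add: field_simps)
  define K where "K = B / (real n + 1)\<^sup>2"
  define p where "p x = c + A * (x - a) + K * (x ^ Suc n - a ^ Suc n)" for x
  define p' where "p' x = A + B * x ^ n / (real n + 1)" for x
  define p'' where "p'' x = B * n * x ^ n0 / (real n + 1)" for x
  have radial: "x * p'' x + p' x = A + B * x ^ n" for x
  proof -
    have "x * p'' x = B * n * x ^ n / (real n + 1)" by (simp add: p''_def n_def)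
    then show ?thesis by (simp add: p'_def add_divide_distrib[symmetric] field_simps)
  qed
  show ?thesis
  proof
    show "(p has_real_derivative p' x) (at x)" for x
    proof -
      have "(p has_real_derivative A + K * ((real n + 1) * x ^ n)) (at x)"
        unfolding p_def[abs_def] by (auto intro!: derivative_eq_intros simp del: power_Suc)
      also have "A + K * ((real n + 1) * x ^ n) = p' x"
      proof -
        have "B / N\<^sup>2 * (N * y) = B * y / N" if "N \<noteq> 0" for N y :: real
          using that by (simp add: power2_eq_square)
        from this[of "real n + 1" "x ^ n"] show ?thesis by (simp add: p'_def K_def)
      qed
      finally show ?thesis .
    qed
    show "(p' has_real_derivative p'' x) (at x)" for x
      unfolding p'_def[abs_def] p''_def
      by (auto intro!: derivative_eq_intros simp: n_def simp del: power_Suc)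
    show "continuous_on UNIV p''" unfolding p''_def[abs_def] by (intro continuous_intros) auto
    show "p a = c" by (simp add: p_def)
    have "real n + 1 \<noteq> 0" by linarith
    then show "p' a = m"
      unfolding p'_def Ba A_def by simp
    show "a * p'' a + p' a = f" unfolding radial f ..
    show "0 < x * p'' x + p' x" if "0 \<le> x" "x \<le> a" for x
    proof -
      define s where "s = (x / a) ^ n"
      have s: "0 \<le> s" "s \<le> 1" using that \<open>0 < a\<close> by (auto simp: s_def power_le_one)
      have "x ^ n = s * a ^ n" using \<open>0 < a\<close> by (simp add: s_def power_divide)
      \<comment> \<open>A convex combination of the values at the two ends.\<close>
      then have "A + B * x ^ n = (1 - s) * A + s * f" by (simp flip: f add: algebra_simps)
      moreover have "0 < (1 - s) * A + s * f"
        using s \<open>0 < A\<close> \<open>0 < f\<close>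
        by (cases "s = 0") (auto intro!: add_nonneg_pos)
      ultimately show ?thesis unfolding radial by simp
    qed
  qed
qed

section \<open>Necessity and sufficiency\<close>

text \<open>
  The outward derivative of the logarithmic density at \<open>C\<^sub>r\<close> is computed from outside, where the metric
  is known, and bounded below from inside, where the metric is only known to be negatively curved.
  The curvature at the points of \<open>C\<^sub>r\<close> itself is negative too, which gives the Laplacian a positive lower
  bound on the closed disc.
\<close>

lemma completion_imp_hyp_potential'_pos:
  assumes "0 < r" "r < 1" and compl: "negatively_curved_completion (ball 0 r) \<rho>"
  shows "0 < hyp_potential' (r\<^sup>2)"
proof -
  obtain u where "C2_on (ball 0 1) u" and \<rho>: "\<And>z. z \<in> ball 0 1 \<Longrightarrow> \<rho> z = exp (u z)"
    using compl unfolding negatively_curved_completion_def by blast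
  have out: "u z = hyp_potential (z \<bullet> z)" if "r \<le> cmod z" "cmod z < 1" for z
  proof -
    have "z \<in> ball 0 1" "z \<in> ball 0 1 - ball 0 r" using that by auto
    then have "exp (u z) = hyp_density z"
      using compl \<rho> unfolding negatively_curved_completion_def by metis
    also have "hyp_density z = exp (hyp_potential (z \<bullet> z))"
      using that assms(1) by (intro hyp_density_eq_exp_potential) linarith+
    finally show ?thesis by simp
  qed
  have outer: "((\<lambda>t. hyp_potential (t\<^sup>2)) has_real_derivative hyp_potential' (r\<^sup>2) * (2 * r)) (at r)"
    using assms by (intro DERIV_chain2[OF DERIV_hyp_potential])
      (auto intro!: derivative_eq_intros simp: power_less_one_iff)
  have "r *\<^sub>R 1 \<in> ball (0::complex) 1" using assms by simp
  then obtain D where D: "((\<lambda>t. u (t *\<^sub>R 1)) has_real_derivative D) (at r)"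
  proof -
    obtain u' where "(u has_derivative blinfun_apply u') (at (0 + r *\<^sub>R 1))"
      using \<open>C2_on (ball 0 1) u\<close> \<open>r *\<^sub>R 1 \<in> ball (0::complex) 1\<close> unfolding C2_on_def
      by (metis add_0)
    from has_vector_derivative_along_line[OF this] show ?thesis
      by (intro that) (simp add: has_real_derivative_iff_has_vector_derivative)
  qed
  have "D = hyp_potential' (r\<^sup>2) * (2 * r)"
  proof (rule DERIV_unique_at_right[OF D outer \<open>r < 1\<close>])
    fix t assume "r \<le> t" "t < 1"
    then show "u (t *\<^sub>R 1) = hyp_potential (t\<^sup>2)"
      using out[of "t *\<^sub>R 1"] \<open>0 < r\<close> by (simp add: dot_square_norm)
  qed
  moreover have "0 < D"
  proof (rule hopf_boundary_derivative[OF \<open>C2_on (ball 0 1) u\<close> open_ball _ \<open>0 < r\<close> norm_one _ _ D])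
    show "cball 0 r \<subseteq> ball (0::complex) 1" using assms by auto
    show "0 < laplacian u z" if "z \<in> cball 0 r" for z
    proof -
      have "z \<in> ball 0 1" using that assms by auto
      moreover from this have "gaussian_curvature \<rho> z < 0"
        using compl unfolding negatively_curved_completion_def by blast
      ultimately show ?thesis using gaussian_curvature_neg_iff[of "ball 0 1" z \<rho> u] \<rho> by simp
    qed
    show "u z \<le> u (r *\<^sub>R 1)" if "cmod z = r" for z
      using out[of z] out[of "r *\<^sub>R 1"] that assms by (simp add: dot_square_norm)
  qed
  ultimately show ?thesis using \<open>0 < r\<close> by (simp add: zero_less_mult_iff)
qed

text \<open>
  The cap is glued to the potential of \<open>ds\<^sup>*\<close> at \<open>a = r\<^sup>2\<close>. It is prescribed through its value, its
  slope and \<open>(x h')'\<close> there, which together determine the second derivative.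
\<close>

lemma hyp_potential'_pos_imp_completion:
  assumes "0 < r" "r < 1" "0 < hyp_potential' (r\<^sup>2)"
  obtains \<rho> where "negatively_curved_completion (ball 0 r) \<rho>"
proof -
  define a where "a = r\<^sup>2"
  have a: "0 < a" "a < 1" using assms by (auto simp: a_def power_less_one_iff)
  obtain p p' p'' :: "real \<Rightarrow> real" where
    p: "\<And>x. (p has_real_derivative p' x) (at x)" and
    p': "\<And>x. (p' has_real_derivative p'' x) (at x)" and
    p'': "continuous_on UNIV p''" and
    match: "p a = hyp_potential a" "p' a = hyp_potential' a"
      "a * p'' a + p' a = a * hyp_potential'' a + hyp_potential' a" and
    pos: "\<And>x. 0 \<le> x \<Longrightarrow> x \<le> a \<Longrightarrow> 0 < x * p'' x + p' x"
    using exists_subharmonic_cap[OF a(1) hyp_potential_subharmonic[OF a] assms(3)[folded a_def],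
        of "hyp_potential a"] by blast
  have match'': "p'' a = hyp_potential'' a" using match(2,3) a by simp
  define h where "h = glue_at a p hyp_potential"
  define h' where "h' = glue_at a p' hyp_potential'"
  define h'' where "h'' = glue_at a p'' hyp_potential''"
  have h: "(h has_real_derivative h' x) (at x)" if "x < 1" for x
    unfolding h_def h'_def
    by (rule DERIV_glue_at[OF p DERIV_hyp_potential match(1,2) that]) (use a in auto)
  have h': "(h' has_real_derivative h'' x) (at x)" if "x < 1" for x
    unfolding h'_def h''_def
    by (rule DERIV_glue_at[OF p' DERIV_hyp_potential' match(2) match'' that]) (use a in auto)
  have "continuous_on {a..<1} hyp_potential''"
    unfolding hyp_potential''_def[abs_def] using a by (intro continuous_intros) auto
  then have h'': "continuous_on {..<1} h''"
    unfolding h''_def using a(2) p'' match''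
    by (intro continuous_on_glue_at continuous_on_subset[OF p'']) auto
  have sq: "z \<bullet> z < 1" if "z \<in> ball 0 1" for z :: complex
    using that by (simp add: dot_square_norm power_less_one_iff)
  define u where "u z = h (z \<bullet> z)" for z :: complex
  have "C2_on (ball 0 1) u"
    unfolding u_def using sq h h' h'' by (intro C2_on_radial[where I = "{..<1}"]) auto
  moreover have "laplacian u z > 0" if z: "z \<in> ball 0 1" for z
  proof -
    have "laplacian u z = 4 * (z \<bullet> z * h'' (z \<bullet> z) + h' (z \<bullet> z))"
      using laplacian_eq_trace_hessian[OF open_ball z, of u "radial_gradient h'" "radial_hessian h' h'' z"]
        trace_radial_hessian[of h' h'' z] sq[OF z] sq
      unfolding u_def
      by (simp add: has_derivative_radial h has_derivative_radial_gradient h' algebra_simps)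
    moreover have "z \<bullet> z * h'' (z \<bullet> z) + h' (z \<bullet> z) > 0"
    proof (cases "z \<bullet> z \<le> a")
      case True
      then show ?thesis using pos[of "z \<bullet> z"] by (simp add: h'_def h''_def glue_at_def)
    next
      case False
      then have "0 < z \<bullet> z" using a(1) by linarith
      with False show ?thesis using hyp_potential_subharmonic[of "z \<bullet> z"] sq[OF z]
        by (simp add: h'_def h''_def glue_at_def del: inner_gt_zero_iff)
    qed
    ultimately show ?thesis by simp
  qed
  moreover have "exp (u z) = hyp_density z" if "z \<in> ball 0 1 - ball 0 r" for z
  proof -
    have z: "r \<le> cmod z" "cmod z < 1" using that by auto
    then have "a \<le> z \<bullet> z" using assms(1) by (simp add: a_def dot_square_norm power_mono)
    then have "u z = hyp_potential (z \<bullet> z)"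
      using match(1) by (cases "z \<bullet> z = a") (auto simp: u_def h_def glue_at_def)
    moreover have "0 < cmod z" using z assms(1) by linarith
    ultimately show ?thesis using hyp_density_eq_exp_potential[of z] z(2) by metis
  qed
  moreover have "gaussian_curvature (\<lambda>z. exp (u z)) z < 0" if "z \<in> ball 0 1" for z
    using calculation(2)[OF that] gaussian_curvature_neg_iff[OF open_ball that, of "\<lambda>z. exp (u z)" u]
    by simp
  ultimately have "negatively_curved_completion (ball 0 r) (\<lambda>z. exp (u z))"
    unfolding negatively_curved_completion_def
  proof (intro conjI ballI exI[of _ u])
    show "ball 0 r \<subseteq> ball (0::complex) 1" using assms(2) by (intro subset_ball) simp
    show "(0::complex) \<in> ball 0 r" using assms(1) by simp
  qed auto
  then show ?thesis by (rule that)
qed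

theorem theorem1:
  fixes r :: real
  assumes "0 < r" and "r < 1"
  shows "(\<exists>\<rho>. negatively_curved_completion (insert 0 (punctured_disc r)) \<rho>) \<longleftrightarrow>
         conformal_length hyp_density (circlepath 0 r) > 2 * pi"
  unfolding insert_0_punctured_disc[OF assms(1)] length_hyp_circle_gt_iff[OF assms]
    hyp_potential'_pos_iff[OF assms, symmetric]
  using completion_imp_hyp_potential'_pos[OF assms] hyp_potential'_pos_imp_completion[OF assms]
  by blast

end
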